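(* Let $A$ be a Frobenius algebra over a field $\Bbbk$ with respect to a non-degenerate associative bilinear form $\langle-,-\rangle$, with Nakayama automorphism $\sigma$, and let $\delta,\eta:A\to A$ be two derivations of $A$. (i) If $z$ is a central element in $A$, then $\mathrm{div}_\sigma(z\delta)=z\,\mathrm{div}_\sigma(\delta)-\delta(z)$. (ii) We have that $\mathrm{div}_\sigma([\delta,\eta])=\delta(\mathrm{div}_\sigma(\eta))-\eta(\mathrm{div}_\sigma(\delta))+[\mathrm{div}_\sigma(\delta),\mathrm{div}_\sigma(\eta)]$.
   Context: $\Bbbk$ is a field; algebras are associative and unital over $\Bbbk$, and derivations are $\Bbbk$-linear. A Frobenius algebra is a finite-dimensional algebra $A$ endowed with a non-degenerate bilinear form $\langle-,-\rangle:A\times A\to\Bbbk$ that is associative: $\langle ab,c\rangle=\langle a,bc\rangle$ for all $a,b,c\in A$. Its Nakayama automorphism is the unique algebra automorphism $\sigma:A\to A$ such that $\langle a,b\rangle=\langle b,\sigma(a)\rangle$ for all $a,b\in A$. The Nakayama divergence of a derivation $\delta:A\to A$ is the unique element $\mathrm{div}_\sigma(\delta)\in A$ such that $\langle\delta(a),b\rangle+\langle a,\delta(b)\rangle=\langle a,b\cdot\mathrm{div}_\sigma(\delta)\rangle$ for all $a,b\in A$. For $z$ central, $z\delta$ is the derivation $a\mapsto z\,\delta(a)$; $[\delta,\eta]=\delta\circ\eta-\eta\circ\delta$; and for $a,b\in A$, $[a,b]=ab-ba$. *)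

theory Defs
  imports Complex_Main
begin

text \<open>
  The sort \<open>{ring, monoid_mult}\<close> is used instead of \<open>ring_1\<close> so that \<open>0 \<noteq> 1\<close> is not imposed and
  the zero algebra is not excluded.
\<close>

locale assoc_algebra = vector_space scale
  for scale :: "'k::field \<Rightarrow> 'a::{ring, monoid_mult} \<Rightarrow> 'a" +
  assumes scale_mult_left: "scale c x * y = scale c (x * y)"
    and scale_mult_right: "x * scale c y = scale c (x * y)"

locale frobenius_algebra = assoc_algebra scale
  for scale :: "'k::field \<Rightarrow> 'a::{ring, monoid_mult} \<Rightarrow> 'a" +
  fixes form :: "'a \<Rightarrow> 'a \<Rightarrow> 'k"
  assumes finite_dim: "\<exists>B. finite B \<and> span B = UNIV"
    and form_linear_left: "Vector_Spaces.linear scale (*) (\<lambda>a. form a b)"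
    and form_linear_right: "Vector_Spaces.linear scale (*) (\<lambda>b. form a b)"
    and form_nondegenerate_left: "(\<And>b. form a b = 0) \<Longrightarrow> a = 0"
    and form_nondegenerate_right: "(\<And>a. form a b = 0) \<Longrightarrow> b = 0"
    and form_assoc: "form (a * b) c = form a (b * c)"

definition algebra_automorphism ::
  "('k::field \<Rightarrow> 'a::{ring, monoid_mult} \<Rightarrow> 'a) \<Rightarrow> ('a \<Rightarrow> 'a) \<Rightarrow> bool" where
  "algebra_automorphism scale \<sigma> \<longleftrightarrow>
     Vector_Spaces.linear scale scale \<sigma> \<and> (\<forall>a b. \<sigma> (a * b) = \<sigma> a * \<sigma> b) \<and> \<sigma> 1 = 1 \<and> bij \<sigma>"

definition nakayama_automorphism ::
  "('k::field \<Rightarrow> 'a::{ring, monoid_mult} \<Rightarrow> 'a) \<Rightarrow> ('a \<Rightarrow> 'a \<Rightarrow> 'k) \<Rightarrow> ('a \<Rightarrow> 'a) \<Rightarrow> bool" where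
  "nakayama_automorphism scale form \<sigma> \<longleftrightarrow>
     algebra_automorphism scale \<sigma> \<and> (\<forall>a b. form a b = form b (\<sigma> a))"

definition derivation ::
  "('k::field \<Rightarrow> 'a::{ring, monoid_mult} \<Rightarrow> 'a) \<Rightarrow> ('a \<Rightarrow> 'a) \<Rightarrow> bool" where
  "derivation scale \<delta> \<longleftrightarrow>
     Vector_Spaces.linear scale scale \<delta> \<and> (\<forall>a b. \<delta> (a * b) = \<delta> a * b + a * \<delta> b)"

text \<open>
  The defining property does not involve the Nakayama automorphism, so it is not a parameter here.
\<close>

definition nakayama_divergence ::
  "('a::{ring, monoid_mult} \<Rightarrow> 'a \<Rightarrow> 'k::field) \<Rightarrow> ('a \<Rightarrow> 'a) \<Rightarrow> 'a" where
  "nakayama_divergence form \<delta> =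
     (THE d. \<forall>a b. form (\<delta> a) b + form a (\<delta> b) = form a (b * d))"

context frobenius_algebra
begin

lemma form_add_left: "form (a + b) c = form a c + form b c"
  using form_linear_left[of c] by (simp add: Vector_Spaces.linear_iff)

lemma form_add_right: "form a (b + c) = form a b + form a c"
  using form_linear_right[of a] by (simp add: Vector_Spaces.linear_iff)

lemma form_scale_left: "form (scale r a) b = r * form a b"
  using form_linear_left[of b] by (simp add: Vector_Spaces.linear_iff)

lemma form_scale_right: "form a (scale r b) = r * form a b"
  using form_linear_right[of a] by (simp add: Vector_Spaces.linear_iff)

lemma form_diff_left: "form (a - b) c = form a c - form b c"
  using form_add_left[of "a - b" b c] by (simp add: algebra_simps)

lemma form_diff_right: "form a (b - c) = form a b - form a c"
  using form_add_right[of a "b - c" c] by (simp add: algebra_simps)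

lemma form_right_cancel: "(\<And>a. form a b = form a c) \<Longrightarrow> b = c"
  using form_nondegenerate_right[of "b - c"] by (simp add: form_diff_right)

lemma form_left_cancel: "(\<And>b. form a b = form c b) \<Longrightarrow> a = c"
  using form_nondegenerate_left[of "a - c"] by (simp add: form_diff_left)

lemma finite_basis:
  obtains B where "finite B" "finite_dimensional_vector_space scale B"
proof -
  obtain S where S: "finite S" "span S = UNIV"
    using finite_dim by blast
  obtain B where B: "B \<subseteq> S" "independent B" "S \<subseteq> span B"
    using maximal_independent_subset by blast
  have "span B = UNIV"
    using S(2) B(3) span_mono[of S "span B"] by (auto simp: span_span)
  moreover have "finite B"
    using B(1) S(1) finite_subset by blast
  ultimately have "finite_dimensional_vector_space scale B"
    using B(2) by unfold_locales auto
  then show thesis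
    using that \<open>finite B\<close> by blast
qed

lemma functional_represented:
  assumes f: "Vector_Spaces.linear scale (*) f"
  shows "\<exists>c. \<forall>a. f a = form a c"
proof -
  obtain B where fin: "finite B" and fd: "finite_dimensional_vector_space scale B"
    using finite_basis by blast
  interpret fd: finite_dimensional_vector_space scale B by (rule fd)
  have eq_on_basis: "g = h"
    if "Vector_Spaces.linear scale (*) g" "Vector_Spaces.linear scale (*) h"
      "\<And>b. b \<in> B \<Longrightarrow> g b = h b" for g h :: "'a \<Rightarrow> 'k"
  proof -
    interpret vp: vector_space_pair scale "(*) :: 'k \<Rightarrow> 'k \<Rightarrow> 'k"
      using that(1) by (simp add: vector_space_pair_def Vector_Spaces.linear_iff)
    show ?thesis
      using vp.linear_eq_on_span[OF that(1,2), of B] that(3) fd.span_Basis by (metis UNIV_I ext)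
  qed
  define T where "T c = (\<Sum>b\<in>B. scale (form b c) b)" for c
  have "Vector_Spaces.linear scale scale T"
    unfolding Vector_Spaces.linear_iff T_def
    by (simp add: vector_space_axioms form_add_right form_scale_right scale_left_distrib
        sum.distrib scale_sum_right)
  moreover have "inj T"
  proof (rule injI)
    fix x y assume "T x = T y"
    then have "(\<Sum>b\<in>B. scale (form b x - form b y) b) = 0"
      by (simp add: T_def scale_left_diff_distrib sum_subtractf)
    then have "form b x = form b y" if "b \<in> B" for b
      using independentD[OF fd.independent_Basis fin subset_refl, where u = "\<lambda>b. form b x - form b y"]
        that by simp
    then have "(\<lambda>a. form a x) = (\<lambda>a. form a y)"
      using form_linear_left by (intro eq_on_basis)
    then show "x = y"
      by (intro form_right_cancel) metis
  qed
  ultimately have "surj T"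
    by (rule fd.linear_inj_imp_surj)
  then obtain c where "T c = (\<Sum>b\<in>B. scale (f b) b)"
    by (metis surjD)
  then have "(\<Sum>b\<in>B. scale (form b c - f b) b) = 0"
    by (simp add: T_def scale_left_diff_distrib sum_subtractf)
  then have "f b = form b c" if "b \<in> B" for b
    using independentD[OF fd.independent_Basis fin subset_refl, where u = "\<lambda>b. form b c - f b"]
      that by simp
  then have "f = (\<lambda>a. form a c)"
    using f form_linear_left by (intro eq_on_basis)
  then show ?thesis
    by metis
qed

lemma nakayama_automorphism_ex1: "\<exists>!\<sigma>. nakayama_automorphism scale form \<sigma>"
proof -
  have "\<exists>\<sigma>. \<forall>a b. form a b = form b (\<sigma> a)"
    using functional_represented[OF form_linear_right] by metis
  then obtain \<sigma> where \<sigma>: "\<And>a b. form a b = form b (\<sigma> a)"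
    by blast
  have one: "\<sigma> 1 = 1"
    by (rule form_right_cancel) (metis \<sigma> form_assoc mult_1 mult_1_right)
  have mult: "\<sigma> (a * b) = \<sigma> a * \<sigma> b" for a b
    by (rule form_right_cancel) (metis \<sigma> form_assoc)
  have add: "\<sigma> (a + b) = \<sigma> a + \<sigma> b" for a b
    by (rule form_right_cancel) (simp add: \<sigma>[symmetric] form_add_right form_add_left)
  have scl: "\<sigma> (scale r a) = scale r (\<sigma> a)" for r a
    by (rule form_right_cancel) (simp add: \<sigma>[symmetric] form_scale_right form_scale_left)
  have lin: "Vector_Spaces.linear scale scale \<sigma>"
    by (simp add: Vector_Spaces.linear_iff vector_space_axioms add scl)
  have inj: "inj \<sigma>"
    by (rule injI, rule form_left_cancel) (metis \<sigma>)
  obtain B where "finite_dimensional_vector_space scale B"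
    using finite_basis by blast
  then have "surj \<sigma>"
    using finite_dimensional_vector_space.linear_inj_imp_surj lin inj by blast
  with inj have "nakayama_automorphism scale form \<sigma>"
    by (simp add: nakayama_automorphism_def algebra_automorphism_def lin one mult bij_def \<sigma>[symmetric])
  moreover have "\<tau> = \<sigma>" if "nakayama_automorphism scale form \<tau>" for \<tau>
  proof
    show "\<tau> a = \<sigma> a" for a
      using that by (intro form_right_cancel) (metis \<sigma> nakayama_automorphism_def)
  qed
  ultimately show ?thesis
    by blast
qed

lemma nakayama_divergence_ex1:
  assumes "derivation scale \<delta>"
  shows "\<exists>!d. \<forall>a b. form (\<delta> a) b + form a (\<delta> b) = form a (b * d)"
proof -
  have \<delta>: "\<delta> (a + b) = \<delta> a + \<delta> b" "\<delta> (scale r a) = scale r (\<delta> a)"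
    "\<delta> (a * b) = \<delta> a * b + a * \<delta> b" for a b r
    using assms by (auto simp: derivation_def Vector_Spaces.linear_iff)
  have "Vector_Spaces.linear scale (*) (\<lambda>a. form (\<delta> a) 1)"
    using form_linear_left[of 1] by (simp add: Vector_Spaces.linear_iff \<delta>)
  then obtain d where d: "\<And>a. form (\<delta> a) 1 = form a d"
    using functional_represented by blast
  have "form (\<delta> a) b + form a (\<delta> b) = form a (b * d)" for a b
  proof -
    have "form (\<delta> a) b + form a (\<delta> b) = form (\<delta> a * b) 1 + form (a * \<delta> b) 1"
      by (simp add: form_assoc)
    also have "\<dots> = form (\<delta> (a * b)) 1"
      by (simp add: \<delta> form_add_left)
    also have "\<dots> = form a (b * d)"
      by (simp add: d form_assoc)
    finally show ?thesis .
  qed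
  moreover have "e = d" if "\<forall>a b. form (\<delta> a) b + form a (\<delta> b) = form a (b * e)" for e
    using that calculation by (intro form_right_cancel) (metis mult_1)
  ultimately show ?thesis
    by blast
qed

end

end

theory Submission imports Defs begin

text \<open>
  A derivation \<open>\<delta>\<close> kills \<open>1\<close>, so \<open>d = div \<delta>\<close> is already determined by \<open>\<langle>\<delta> a, 1\<rangle> = \<langle>a, d\<rangle>\<close>.
  Both formulas then follow by moving derivations to the right-hand argument through
  \<open>\<langle>\<delta> a, b\<rangle> = \<langle>a, b d - \<delta> b\<rangle>\<close>: once for \<open>\<langle>z \<delta> a, 1\<rangle> = \<langle>\<delta> a, z\<rangle>\<close>, twice for \<open>\<langle>\<delta> (\<eta> a), 1\<rangle>\<close>.
\<close>

lemma derivation_add: "derivation scale \<delta> \<Longrightarrow> \<delta> (a + b) = \<delta> a + \<delta> b"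
  by (simp add: derivation_def Vector_Spaces.linear_iff)

lemma derivation_scale: "derivation scale \<delta> \<Longrightarrow> \<delta> (scale r a) = scale r (\<delta> a)"
  by (simp add: derivation_def Vector_Spaces.linear_iff)

lemma derivation_mult: "derivation scale \<delta> \<Longrightarrow> \<delta> (a * b) = \<delta> a * b + a * \<delta> b"
  by (simp add: derivation_def)

lemma derivation_one: "derivation scale \<delta> \<Longrightarrow> \<delta> 1 = 0"
  by (metis add_cancel_right_right derivation_mult mult_1 mult_1_right)

context assoc_algebra
begin

text \<open>Centrality moves \<open>z\<close> past \<open>a\<close> in the second Leibniz term.
  Being a derivation is what guarantees that the divergence of \<open>z * \<delta> a\<close>
  exists.\<close>

lemma derivation_central_mult:
  assumes "derivation scale \<delta>" and "\<And>a. z * a = a * z"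
  shows "derivation scale (\<lambda>a. z * \<delta> a)"
proof -
  have "z * (a * \<delta> b) = a * (z * \<delta> b)" for a b
    by (metis assms(2) mult.assoc)
  then show ?thesis
    unfolding derivation_def Vector_Spaces.linear_iff
    by (simp add: vector_space_axioms derivation_add[OF assms(1)] derivation_scale[OF assms(1)]
        derivation_mult[OF assms(1)] distrib_left scale_mult_right mult.assoc)
qed

text \<open>The mixed terms \<open>\<delta> a * \<eta> b\<close> and
  \<open>\<eta> a * \<delta> b\<close> occur in both composites and cancel.\<close>

lemma derivation_commutator:
  assumes "derivation scale \<delta>" and "derivation scale \<eta>"
  shows "derivation scale (\<lambda>a. \<delta> (\<eta> a) - \<eta> (\<delta> a))"
  unfolding derivation_def Vector_Spaces.linear_iff
  by (simp add: vector_space_axioms assms[THEN derivation_add] assms[THEN derivation_scale]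
      assms[THEN derivation_mult] algebra_simps)

end

context frobenius_algebra
begin

text \<open>This gives the adjoint of \<open>\<delta>\<close> with respect to the form; unique
  existence makes the \<open>THE\<close> in the divergence satisfy its defining equation.\<close>

lemma form_derivation_left:
  assumes "derivation scale \<delta>"
  shows "form (\<delta> a) b = form a (b * nakayama_divergence form \<delta> - \<delta> b)"
proof -
  have "form (\<delta> a) b + form a (\<delta> b) = form a (b * nakayama_divergence form \<delta>)"
    using theI'[OF nakayama_divergence_ex1[OF assms]]
    unfolding nakayama_divergence_def by blast
  then show ?thesis
    by (simp add: form_diff_right eq_diff_eq)
qed

text \<open>At \<open>b = 1\<close> the adjoint is the divergence itself, since
  \<open>\<delta> 1 = 0\<close>; nondegeneracy then identifies it with \<open>d\<close>.\<close>

lemma nakayama_divergence_eqI: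
  assumes "derivation scale \<delta>" and "\<And>a. form (\<delta> a) 1 = form a d"
  shows "nakayama_divergence form \<delta> = d"
  using form_derivation_left[OF assms(1), of _ 1] assms
  by (intro form_right_cancel) (simp add: derivation_one)

lemma nakayama_divergence_central_mult:
  assumes \<delta>: "derivation scale \<delta>" and z: "\<And>a. z * a = a * z"
  shows "nakayama_divergence form (\<lambda>a. z * \<delta> a) = z * nakayama_divergence form \<delta> - \<delta> z"
proof (rule nakayama_divergence_eqI[OF derivation_central_mult[OF assms]])
  fix a
  \<comment> \<open>Centrality turns \<open>z * \<delta> a\<close> into
    \<open>\<delta> a * z\<close>, and associativity of the form passes \<open>z\<close> to the
    right.\<close>
  have "form (z * \<delta> a) 1 = form (\<delta> a) z"
    by (metis z form_assoc mult_1_right)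
  then show "form (z * \<delta> a) 1 = form a (z * nakayama_divergence form \<delta> - \<delta> z)"
    by (simp add: form_derivation_left[OF \<delta>])
qed

lemma nakayama_divergence_commutator:
  assumes \<delta>: "derivation scale \<delta>" and \<eta>: "derivation scale \<eta>"
  shows "nakayama_divergence form (\<lambda>a. \<delta> (\<eta> a) - \<eta> (\<delta> a))
       = \<delta> (nakayama_divergence form \<eta>) - \<eta> (nakayama_divergence form \<delta>)
         + (nakayama_divergence form \<delta> * nakayama_divergence form \<eta>
            - nakayama_divergence form \<eta> * nakayama_divergence form \<delta>)"
  \<comment> \<open>Write d, e for the divergences of \<open>\<delta>\<close>,
    \<open>\<eta>\<close>. Then \<open>form (\<delta> (\<eta> a)) 1\<close> equals
    \<open>form (\<eta> a) d\<close>, hence \<open>form a (d * e - \<eta> d)\<close>; subtract the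
    same with the roles swapped.\<close>
  by (rule nakayama_divergence_eqI[OF derivation_commutator[OF assms]])
    (simp add: form_diff_left form_derivation_left[OF \<delta>] form_derivation_left[OF \<eta>]
      derivation_one[OF \<delta>] derivation_one[OF \<eta>] form_diff_right form_add_right)

end

theorem proposition9:
  fixes scale :: "'k::field \<Rightarrow> 'a::{ring, monoid_mult} \<Rightarrow> 'a"
    and form :: "'a \<Rightarrow> 'a \<Rightarrow> 'k"
    and \<sigma> \<delta> \<eta> :: "'a \<Rightarrow> 'a"
  assumes "frobenius_algebra scale form"
    and "nakayama_automorphism scale form \<sigma>"
    and "derivation scale \<delta>"
    and "derivation scale \<eta>"
  shows "(\<forall>z. (\<forall>a. z * a = a * z) \<longrightarrow>
            nakayama_divergence form (\<lambda>a. z * \<delta> a) = z * nakayama_divergence form \<delta> - \<delta> z)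
       \<and> nakayama_divergence form (\<lambda>a. \<delta> (\<eta> a) - \<eta> (\<delta> a))
           = \<delta> (nakayama_divergence form \<eta>) - \<eta> (nakayama_divergence form \<delta>)
             + (nakayama_divergence form \<delta> * nakayama_divergence form \<eta>
                - nakayama_divergence form \<eta> * nakayama_divergence form \<delta>)"
proof -
  interpret frobenius_algebra scale form by (rule assms(1))
  show ?thesis
    using nakayama_divergence_central_mult[OF assms(3)]
      nakayama_divergence_commutator[OF assms(3,4)] by blast
qed

end
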